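(* Let $p=(v_1,\dots,v_n)$ be a polygon in the Euclidean plane $E^2=\mathbb{R}^2$, let $\alpha_1,\dots,\alpha_n$ be its angles, and let $\dot\alpha_1,\dots,\dot\alpha_n\in\mathbb{R}$. Suppose that there exists an isometric first-order deformation of $p$ such that the induced first-order variation of the angles of $p$ is $(\dot\alpha_1,\dots,\dot\alpha_n)$. Then $$\sum_{i=1}^n\dot\alpha_i=0\quad\text{and}\quad \sum_{i=1}^n\dot\alpha_i v_i=0 .$$ Conversely, if $\dot\alpha_1,\dots,\dot\alpha_n\in\mathbb{R}$ satisfy these two equations and the vertices of $p$ are not all on a line, then there exists an isometric first-order deformation of $p$ whose induced first-order variation of the angles $\alpha_i$ is given by the $\dot\alpha_i$, and it is unique up to the addition of a trivial deformation.
   Context: A polygon with $n\ge 3$ vertices in $E^2$ is a finite sequence $p=(v_1,\dots,v_n)$ of points with $v_i\ne v_{i+1}$ for all $i$ (indices modulo $n$, so $v_0=v_n$, $v_{n+1}=v_1$). Its edge lengths are $l_i=\|v_{i+1}-v_i\|$. The angle $\alpha_i\in\mathbb{R}/2\pi\mathbb{Z}$ at $v_i$ is the oriented angle from the direction of $v_{i+1}-v_i$ to the direction of $v_{i-1}-v_i$ (for a fixed orientation of the plane). A first-order deformation of $p$ is an $n$-tuple of vectors $(\dot v_1,\dots,\dot v_n)$, $\dot v_i\in T_{v_i}E^2=\mathbb{R}^2$; it is isometric if $\langle v_{i+1}-v_i,\dot v_{i+1}-\dot v_i\rangle=0$ for all $i$ (i.e. the edge lengths do not change at first order), and trivial if there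 is a Killing field $\kappa$ of $E^2$ with $\dot v_i=\kappa(v_i)$ for all $i$. The induced first-order variation of the angles is the derivative of $(\alpha_1,\dots,\alpha_n)$ in the direction $(\dot v_1,\dots,\dot v_n)$. *)

theory Defs
  imports "HOL-Analysis.Analysis"
begin

text \<open>The circle of angles, \<open>\<real> / 2\<pi>\<int>\<close>; the class of \<open>\<theta>\<close> is \<open>angle_of \<theta>\<close>.\<close>

definition angle_rel :: "real \<Rightarrow> real \<Rightarrow> bool" where
  "angle_rel x y \<longleftrightarrow> (\<exists>k::int. x - y = 2 * pi * of_int k)"

lemma equivp_angle_rel: "equivp angle_rel"
proof (rule equivpI)
  show "reflp angle_rel"
    by (auto simp: reflp_def angle_rel_def intro: exI[of _ 0])
  show "symp angle_rel"
  proof (rule sympI)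
    fix x y assume "angle_rel x y"
    then obtain k :: int where "x - y = 2 * pi * of_int k"
      by (auto simp: angle_rel_def)
    then have "y - x = 2 * pi * of_int (- k)" by simp
    then show "angle_rel y x" unfolding angle_rel_def by blast
  qed
  show "transp angle_rel"
  proof (rule transpI)
    fix x y z assume "angle_rel x y" "angle_rel y z"
    then obtain k l :: int where "x - y = 2 * pi * of_int k" "y - z = 2 * pi * of_int l"
      by (auto simp: angle_rel_def)
    then have "x - z = 2 * pi * of_int (k + l)" by (simp add: algebra_simps)
    then show "angle_rel x z" unfolding angle_rel_def by blast
  qed
qed

quotient_type angle = real / angle_rel
  morphisms rep_angle angle_of
  by (rule equivp_angle_rel)

definition rotate2 :: "real \<Rightarrow> real^2 \<Rightarrow> real^2" where
  "rotate2 \<theta> u = vector [cos \<theta> * u $ 1 - sin \<theta> * u $ 2, sin \<theta> * u $ 1 + cos \<theta> * u $ 2]"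

text \<open>The plane carries its standard (counterclockwise) orientation, and \<open>sgn u\<close> is the
  direction \<open>u / \<parallel>u\<parallel>\<close>.  The value is meaningful only for nonzero \<open>u\<close> and \<open>w\<close>.\<close>

definition oriented_angle :: "real^2 \<Rightarrow> real^2 \<Rightarrow> angle" where
  "oriented_angle u w = (THE a. \<exists>\<theta>. a = angle_of \<theta> \<and> rotate2 \<theta> (sgn u) = sgn w)"

lemma angle_of_eq_iff: "angle_of x = angle_of y \<longleftrightarrow> (\<exists>k::int. x - y = 2 * pi * of_int k)"
  by (simp add: angle.abs_eq_iff angle_rel_def)

lemma oriented_angle_eq_iff:
  assumes "u \<noteq> 0" "w \<noteq> 0"
  shows "oriented_angle u w = angle_of \<theta> \<longleftrightarrow> rotate2 \<theta> (sgn u) = sgn w"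
proof -
  define a b where "a = sgn u $ 1" and "b = sgn u $ 2"
  define c d where "c = sgn w $ 1" and "d = sgn w $ 2"
  have norm2: "(sgn x $ 1)\<^sup>2 + (sgn x $ 2)\<^sup>2 = 1" if "x \<noteq> 0" for x :: "real^2"
    using norm_sgn[of x] that by (simp add: norm_vec_def L2_set_def sum_2)
  have ab: "a\<^sup>2 + b\<^sup>2 = 1" and cd: "c\<^sup>2 + d\<^sup>2 = 1"
    using norm2 assms by (auto simp: a_def b_def c_def d_def)
  have rot: "rotate2 t (sgn u) = sgn w \<longleftrightarrow> cos t * a - sin t * b = c \<and> sin t * a + cos t * b = d" for t
    by (simp add: rotate2_def vec_eq_iff forall_2 a_def b_def c_def d_def)
  have rot': "rotate2 t (sgn u) = sgn w \<longleftrightarrow> cos t = a * c + b * d \<and> sin t = a * d - b * c" for t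
  proof
    assume "rotate2 t (sgn u) = sgn w"
    then have c: "c = cos t * a - sin t * b" and d: "d = sin t * a + cos t * b" by (auto simp: rot)
    have "a * c + b * d = cos t * (a\<^sup>2 + b\<^sup>2)" "a * d - b * c = sin t * (a\<^sup>2 + b\<^sup>2)"
      unfolding c d by (simp_all add: algebra_simps power2_eq_square)
    then show "cos t = a * c + b * d \<and> sin t = a * d - b * c" by (simp add: ab)
  next
    assume "cos t = a * c + b * d \<and> sin t = a * d - b * c"
    then have t: "cos t = a * c + b * d" "sin t = a * d - b * c" by auto
    have "cos t * a - sin t * b = c * (a\<^sup>2 + b\<^sup>2)" "sin t * a + cos t * b = d * (a\<^sup>2 + b\<^sup>2)"
      unfolding t by (simp_all add: algebra_simps power2_eq_square)
    then show "rotate2 t (sgn u) = sgn w" by (simp add: rot ab)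
  qed
  have "(a * c + b * d)\<^sup>2 + (a * d - b * c)\<^sup>2 = (a\<^sup>2 + b\<^sup>2) * (c\<^sup>2 + d\<^sup>2)"
    by (simp add: algebra_simps power2_eq_square)
  then have "(a * c + b * d)\<^sup>2 + (a * d - b * c)\<^sup>2 = 1" by (simp add: ab cd)
  then obtain t where t: "a * c + b * d = cos t" "a * d - b * c = sin t"
    by (rule sincos_total_2pi) blast
  have iff: "rotate2 s (sgn u) = sgn w \<longleftrightarrow> angle_of s = angle_of t" for s
  proof -
    have "cos s = cos t \<and> sin s = sin t \<longleftrightarrow> (\<exists>k::int. s = t + 2 * pi * of_int k)"
      using sin_cos_eq_iff[of s t] by auto
    also have "\<dots> \<longleftrightarrow> angle_of s = angle_of t"
      by (auto simp: angle_of_eq_iff algebra_simps)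
    finally show ?thesis by (auto simp: rot' t)
  qed
  have "oriented_angle u w = angle_of t"
    unfolding oriented_angle_def iff by (rule the_equality) auto
  then show ?thesis by (auto simp: iff)
qed

text \<open>Derivative of a curve in \<open>\<real> / 2\<pi>\<int>\<close>: the derivative of a local lift to \<open>\<real>\<close>.
  Two lifts that are differentiable at \<open>t\<close> differ by a constant near \<open>t\<close>, so the
  derivative does not depend on the lift.\<close>

definition has_angle_derivative :: "(real \<Rightarrow> angle) \<Rightarrow> real \<Rightarrow> real \<Rightarrow> bool" where
  "has_angle_derivative f d t \<longleftrightarrow>
     (\<exists>\<phi>. (\<forall>\<^sub>F s in nhds t. f s = angle_of (\<phi> s)) \<and> (\<phi> has_real_derivative d) (at t))"

lemma has_angle_derivative_unique:
  assumes "has_angle_derivative f d t" "has_angle_derivative f e t"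
  shows "d = e"
proof -
  obtain \<phi> \<psi> where \<phi>: "\<forall>\<^sub>F s in nhds t. f s = angle_of (\<phi> s)" "(\<phi> has_real_derivative d) (at t)"
    and \<psi>: "\<forall>\<^sub>F s in nhds t. f s = angle_of (\<psi> s)" "(\<psi> has_real_derivative e) (at t)"
    using assms by (auto simp: has_angle_derivative_def)
  define g where "g s = \<phi> s - \<psi> s" for s
  have g': "(g has_real_derivative (d - e)) (at t)"
    unfolding g_def by (intro DERIV_diff \<phi> \<psi>)
  have per: "\<forall>\<^sub>F s in nhds t. \<exists>k::int. g s = 2 * pi * of_int k"
    using \<phi>(1) \<psi>(1) by eventually_elim (auto simp: g_def angle_of_eq_iff[symmetric])
  obtain k0 :: int where k0: "g t = 2 * pi * of_int k0"
    using eventually_nhds_x_imp_x[OF per] by blast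
  have "(g \<longlongrightarrow> g t) (nhds t)"
    using DERIV_isCont[OF g'] by (simp add: isCont_def tendsto_at_iff_tendsto_nhds)
  then have "\<forall>\<^sub>F s in nhds t. dist (g s) (g t) < 2 * pi"
    by (rule tendstoD) simp
  with per have "\<forall>\<^sub>F s in nhds t. g s = g t"
  proof eventually_elim
    case (elim s)
    then obtain k :: int where k: "g s = 2 * pi * of_int k" by blast
    have "g s - g t = 2 * pi * of_int (k - k0)" using k k0 by (simp add: algebra_simps)
    then have "2 * pi * \<bar>of_int (k - k0) :: real\<bar> < 2 * pi * 1"
      using elim by (simp add: dist_real_def abs_mult)
    then have "\<bar>of_int (k - k0) :: real\<bar> < 1"
      by (rule mult_left_less_imp_less) simp
    then have "k = k0" by linarith
    then show ?case using k k0 by simp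
  qed
  then have "(g has_real_derivative 0) (at t)"
    by (subst DERIV_cong_ev[OF refl _ refl]) auto
  then show ?thesis using DERIV_unique[OF g', of 0] by simp
qed

text \<open>Vertices are indexed by \<open>1, \<dots>, n\<close>, cyclically; values of the functions below outside
  \<open>{1..n}\<close> are irrelevant.\<close>

definition next_ix :: "nat \<Rightarrow> nat \<Rightarrow> nat" where
  "next_ix n i = (if i = n then 1 else i + 1)"

definition prev_ix :: "nat \<Rightarrow> nat \<Rightarrow> nat" where
  "prev_ix n i = (if i = 1 then n else i - 1)"

definition polygon :: "nat \<Rightarrow> (nat \<Rightarrow> real^2) \<Rightarrow> bool" where
  "polygon n v \<longleftrightarrow> n \<ge> 3 \<and> (\<forall>i\<in>{1..n}. v i \<noteq> v (next_ix n i))"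

definition polygon_angle :: "nat \<Rightarrow> (nat \<Rightarrow> real^2) \<Rightarrow> nat \<Rightarrow> angle" where
  "polygon_angle n v i = oriented_angle (v (next_ix n i) - v i) (v (prev_ix n i) - v i)"

definition isometric_deformation :: "nat \<Rightarrow> (nat \<Rightarrow> real^2) \<Rightarrow> (nat \<Rightarrow> real^2) \<Rightarrow> bool" where
  "isometric_deformation n v w \<longleftrightarrow>
     (\<forall>i\<in>{1..n}. (v (next_ix n i) - v i) \<bullet> (w (next_ix n i) - w i) = 0)"

text \<open>Killing's equation \<open>\<L>\<^sub>\<kappa> g = 0\<close> for the flat metric of the plane.  Smoothness need not be
  required separately: by \<open>killing_field_affine\<close> below, solutions are affine.\<close>

definition killing_field :: "(real^2 \<Rightarrow> real^2) \<Rightarrow> bool" where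
  "killing_field \<kappa> \<longleftrightarrow>
     (\<forall>x. \<exists>D. (\<kappa> has_derivative D) (at x) \<and> (\<forall>u w. D u \<bullet> w + u \<bullet> D w = 0))"

lemma killing_field_affine:
  assumes "killing_field \<kappa>"
  shows "linear (\<lambda>x. \<kappa> x - \<kappa> 0)"
proof -
  obtain D where D: "\<And>x. (\<kappa> has_derivative D x) (at x)" "\<And>x u w. D x u \<bullet> w + u \<bullet> D x w = 0"
    using assms unfolding killing_field_def by metis
  have orth: "(\<kappa> x - \<kappa> y) \<bullet> (x - y) = 0" for x y
  proof -
    define f where "f t = \<kappa> (y + t *\<^sub>R (x - y)) \<bullet> (x - y)" for t :: real
    have "(f has_real_derivative 0) (at t)" for t
    proof -
      have "(f has_derivative (\<lambda>h. D (y + t *\<^sub>R (x - y)) (h *\<^sub>R (x - y)) \<bullet> (x - y))) (at t)"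
        unfolding f_def
        by (rule derivative_eq_intros has_derivative_compose[OF _ D(1)] | simp)+
      moreover have "D (y + t *\<^sub>R (x - y)) (h *\<^sub>R (x - y)) \<bullet> (x - y) = 0" for h
      proof -
        have "linear (D (y + t *\<^sub>R (x - y)))" using D(1) has_derivative_linear by blast
        then show ?thesis
          using D(2)[of "y + t *\<^sub>R (x - y)" "x - y" "x - y"]
          by (simp add: linear_cmul inner_commute)
      qed
      ultimately show ?thesis by (simp add: has_field_derivative_def lambda_zero[symmetric])
    qed
    then have "f 1 = f 0" using DERIV_isconst_all by blast
    then show ?thesis by (simp add: f_def inner_diff_left)
  qed
  define L where "L x = \<kappa> x - \<kappa> 0" for x
  have skew: "L x \<bullet> y = - (L y \<bullet> x)" for x y
  proof -
    have "L x \<bullet> x = 0" "L y \<bullet> y = 0" "(L x - L y) \<bullet> (x - y) = 0"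
      using orth[of x 0] orth[of y 0] orth[of x y] by (auto simp: L_def)
    then show ?thesis by (simp add: inner_diff_left inner_diff_right)
  qed
  have "linear L"
  proof (rule linearI)
    fix x y
    have "(L (x + y) - (L x + L y)) \<bullet> z = 0" for z
      by (simp add: inner_diff_left inner_add_left skew[of _ z] inner_add_right)
    then show "L (x + y) = L x + L y" by (metis inner_eq_zero_iff right_minus_eq)
  next
    fix c x
    have "(L (c *\<^sub>R x) - c *\<^sub>R L x) \<bullet> z = 0" for z
      by (simp add: inner_diff_left skew[of _ z])
    then show "L (c *\<^sub>R x) = c *\<^sub>R L x" by (metis inner_eq_zero_iff right_minus_eq)
  qed
  then show ?thesis unfolding L_def .
qed

definition trivial_deformation :: "nat \<Rightarrow> (nat \<Rightarrow> real^2) \<Rightarrow> (nat \<Rightarrow> real^2) \<Rightarrow> bool" where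
  "trivial_deformation n v w \<longleftrightarrow> (\<exists>\<kappa>. killing_field \<kappa> \<and> (\<forall>i\<in>{1..n}. w i = \<kappa> (v i)))"

definition induces_angle_variation ::
  "nat \<Rightarrow> (nat \<Rightarrow> real^2) \<Rightarrow> (nat \<Rightarrow> real^2) \<Rightarrow> (nat \<Rightarrow> real) \<Rightarrow> bool" where
  "induces_angle_variation n v w a \<longleftrightarrow>
     (\<forall>i\<in>{1..n}. has_angle_derivative (\<lambda>t. polygon_angle n (\<lambda>j. v j + t *\<^sub>R w j) i) (a i) 0)"

end

theory Submission
  imports Defs
begin

text \<open>An isometric deformation rotates the \<open>i\<close>-th edge \<open>e\<^sub>i = v\<^sub>i\<^sub>+\<^sub>1 - v\<^sub>i\<close> at some rate \<open>\<omega>\<^sub>i\<close>, that is,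
  it moves \<open>e\<^sub>i\<close> by \<open>\<omega>\<^sub>i J e\<^sub>i\<close> with \<open>J\<close> the rotation by \<open>\<pi>/2\<close>, and the angle at \<open>v\<^sub>i\<close> then varies by
  \<open>\<omega>\<^sub>i\<^sub>-\<^sub>1 - \<omega>\<^sub>i\<close>.  Rates \<open>\<omega>\<^sub>i\<close> come from a deformation iff the polygon stays closed, \<open>\<Sum> \<omega>\<^sub>i e\<^sub>i = 0\<close>;
  by summation by parts this sum is \<open>\<Sum> (\<omega>\<^sub>i\<^sub>-\<^sub>1 - \<omega>\<^sub>i) v\<^sub>i\<close>.  The angle variations determine the \<open>\<omega>\<^sub>i\<close> up
  to a common constant, which is an infinitesimal rotation.\<close>

section \<open>The quarter turn and rotations of the plane\<close>

definition perp :: "real^2 \<Rightarrow> real^2" where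
  "perp u = vector [- u $ 2, u $ 1]"

lemma perp_nth [simp]: "perp u $ 1 = - u $ 2" "perp u $ 2 = u $ 1"
  by (simp_all add: perp_def)

lemma inner_vec2: "u \<bullet> w = u $ 1 * w $ 1 + u $ 2 * w $ 2" for u w :: "real^2"
  by (simp add: inner_vec_def sum_2)

lemma inner_perp_perp: "perp u \<bullet> perp w = u \<bullet> w"
  by (simp add: inner_vec2)

lemma linear_perp: "linear perp"
  by (rule linearI) (simp_all add: vec_eq_iff forall_2)

lemma perp_decomp: "(u \<bullet> u) *\<^sub>R y = (u \<bullet> y) *\<^sub>R u + (perp u \<bullet> y) *\<^sub>R perp u"
  by (simp add: vec_eq_iff forall_2 inner_vec2 algebra_simps)

lemma rotate2_eq: "rotate2 \<theta> u = cos \<theta> *\<^sub>R u + sin \<theta> *\<^sub>R perp u"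
  by (simp add: vec_eq_iff forall_2 rotate2_def)

lemma rotate2_add: "rotate2 (\<alpha> + \<beta>) u = rotate2 \<alpha> (rotate2 \<beta> u)"
  by (simp add: vec_eq_iff forall_2 rotate2_def sin_add cos_add algebra_simps)

lemma rotate2_0 [simp]: "rotate2 0 u = u"
  by (simp add: rotate2_eq)

lemma norm_rotate2 [simp]: "norm (rotate2 \<theta> u) = norm u"
proof -
  have "rotate2 \<theta> u \<bullet> rotate2 \<theta> u = ((sin \<theta>)\<^sup>2 + (cos \<theta>)\<^sup>2) * (u \<bullet> u)"
    by (simp only: inner_vec2 rotate2_def vector_2) algebra
  then show ?thesis by (simp add: norm_eq_sqrt_inner)
qed

lemma sgn_rotate2: "sgn (rotate2 \<theta> u) = rotate2 \<theta> (sgn u)"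
proof -
  have "rotate2 \<theta> (c *\<^sub>R u) = c *\<^sub>R rotate2 \<theta> u" for c
    by (simp add: rotate2_eq linear_cmul[OF linear_perp] algebra_simps)
  then show ?thesis by (simp add: sgn_div_norm)
qed

text \<open>For \<open>y\<close> in the open half-plane around \<open>u\<close>, the signed angle
  from \<open>u\<close> to \<open>y\<close> lies strictly between -pi/2 and pi/2, so
  \<open>arctan\<close> of its tangent recovers it without any case split on branches.\<close>

lemma rotate2_arctan:
  assumes "u \<bullet> y > 0"
  shows "rotate2 (arctan ((perp u \<bullet> y) / (u \<bullet> y))) (sgn u) = sgn y"
proof -
  define g where "g = (perp u \<bullet> y) / (u \<bullet> y)"
  \<comment> \<open>The factor with \<open>rotate2 (arctan g) u = k *\<^sub>R y\<close>; only its
    sign matters, since \<open>sgn\<close> ignores positive factors.\<close>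
  define k where "k = (u \<bullet> u) / (sqrt (1 + g\<^sup>2) * (u \<bullet> y))"
  have "u \<noteq> 0" using assms by auto
  have pos: "1 + g\<^sup>2 > 0" by (simp add: add_pos_nonneg)
  have "rotate2 (arctan g) u = (1 / sqrt (1 + g\<^sup>2)) *\<^sub>R (u + g *\<^sub>R perp u)"
    by (simp add: rotate2_eq cos_arctan sin_arctan scaleR_add_right)
  also have "u + g *\<^sub>R perp u = (1 / (u \<bullet> y)) *\<^sub>R ((u \<bullet> u) *\<^sub>R y)"
    unfolding perp_decomp[of u y] using assms by (simp add: g_def scaleR_add_right)
  finally have "rotate2 (arctan g) u = k *\<^sub>R y" by (simp add: k_def)
  moreover have "k > 0" using assms pos \<open>u \<noteq> 0\<close> by (simp add: k_def)
  ultimately have "sgn (rotate2 (arctan g) u) = sgn y" by (simp add: sgn_scaleR)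
  then show ?thesis by (simp add: sgn_rotate2 g_def)
qed

section \<open>Angular velocity of a moving vector and of an oriented angle\<close>

definition rotation_rate :: "real^2 \<Rightarrow> real^2 \<Rightarrow> real" where
  "rotation_rate u d = (perp u \<bullet> d) / (u \<bullet> u)"

lemma rotation_rate_minus: "rotation_rate (- u) (- d) = rotation_rate u d"
  by (simp add: rotation_rate_def linear_neg[OF linear_perp])

text \<open>For t near 0 the moving vector stays in the half-plane around \<open>u\<close>, so
  \<open>rotate2_arctan\<close> yields an explicit real lift of its direction, measured from
  \<open>u\<close>.\<close>

lemma direction_lift:
  assumes "u \<noteq> 0"
  obtains \<alpha> where "\<forall>\<^sub>F t in nhds 0. u + t *\<^sub>R d \<noteq> 0 \<and> rotate2 (\<alpha> t) (sgn u) = sgn (u + t *\<^sub>R d)"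
    "(\<alpha> has_real_derivative rotation_rate u d) (at 0)"
proof
  let ?\<alpha> = "\<lambda>t. arctan ((perp u \<bullet> (u + t *\<^sub>R d)) / (u \<bullet> (u + t *\<^sub>R d)))"
  have "((\<lambda>t. u \<bullet> (u + t *\<^sub>R d)) \<longlongrightarrow> u \<bullet> (u + 0 *\<^sub>R d)) (nhds 0)"
    by (intro tendsto_intros filterlim_ident)
  then have "\<forall>\<^sub>F t in nhds 0. u \<bullet> (u + t *\<^sub>R d) > 0"
    using assms by (intro order_tendstoD(1)) auto
  then show "\<forall>\<^sub>F t in nhds 0. u + t *\<^sub>R d \<noteq> 0 \<and> rotate2 (?\<alpha> t) (sgn u) = sgn (u + t *\<^sub>R d)"
    by eventually_elim (use rotate2_arctan in fastforce)
  \<comment> \<open>This removes the constant term of the numerator: the quotient vanishes at t = 0,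
    where \<open>arctan\<close> has slope 1.\<close>
  have perp_self: "perp u \<bullet> u = 0" by (simp add: inner_vec2)
  have "((\<lambda>t. arctan ((t * (perp u \<bullet> d)) / (u \<bullet> u + t * (u \<bullet> d))))
      has_real_derivative rotation_rate u d) (at 0)"
    using assms
    by (auto intro!: derivative_eq_intros simp: rotation_rate_def)
  then show "(?\<alpha> has_real_derivative rotation_rate u d) (at 0)"
    by (simp add: inner_add_right perp_self)
qed

lemma has_angle_derivative_oriented_angle:
  assumes "u \<noteq> 0" "z \<noteq> 0"
  shows "has_angle_derivative (\<lambda>t. oriented_angle (u + t *\<^sub>R d) (z + t *\<^sub>R f))
    (rotation_rate z f - rotation_rate u d) 0"
proof -
  obtain \<alpha> where \<alpha>: "\<forall>\<^sub>F t in nhds 0. u + t *\<^sub>R d \<noteq> 0 \<and> rotate2 (\<alpha> t) (sgn u) = sgn (u + t *\<^sub>R d)"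
    "(\<alpha> has_real_derivative rotation_rate u d) (at 0)"
    using direction_lift assms by blast
  obtain \<beta> where \<beta>: "\<forall>\<^sub>F t in nhds 0. z + t *\<^sub>R f \<noteq> 0 \<and> rotate2 (\<beta> t) (sgn z) = sgn (z + t *\<^sub>R f)"
    "(\<beta> has_real_derivative rotation_rate z f) (at 0)"
    using direction_lift assms by blast
  obtain \<theta> where "oriented_angle u z = angle_of \<theta>"
    using angle.abs_induct[of "\<lambda>x. \<exists>\<theta>. x = angle_of \<theta>"] by blast
  then have \<theta>: "rotate2 \<theta> (sgn u) = sgn z"
    using assms by (simp add: oriented_angle_eq_iff)
  \<comment> \<open>Turn back from the moved \<open>u\<close> to \<open>u\<close>, across to
    \<open>z\<close>, then on to the moved \<open>z\<close>; only the outer two turns depend on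
    t.\<close>
  let ?\<phi> = "\<lambda>t. \<beta> t + (\<theta> + (- \<alpha> t))"
  have "\<forall>\<^sub>F t in nhds 0. oriented_angle (u + t *\<^sub>R d) (z + t *\<^sub>R f) = angle_of (?\<phi> t)"
    using \<alpha>(1) \<beta>(1)
  proof eventually_elim
    case (elim t)
    have "rotate2 (- \<alpha> t) (sgn (u + t *\<^sub>R d)) = sgn u"
      using elim rotate2_add[of "- \<alpha> t" "\<alpha> t" "sgn u"] by simp
    then have "rotate2 (?\<phi> t) (sgn (u + t *\<^sub>R d)) = sgn (z + t *\<^sub>R f)"
      using elim \<theta> by (simp only: rotate2_add)
    then show ?case using elim by (simp add: oriented_angle_eq_iff)
  qed
  moreover have "(?\<phi> has_real_derivative (rotation_rate z f - rotation_rate u d)) (at 0)"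
    using \<alpha>(2) \<beta>(2) by (auto intro!: derivative_eq_intros)
  ultimately show ?thesis unfolding has_angle_derivative_def by (intro exI[of _ ?\<phi>] conjI)
qed

lemma orthogonal_iff_rotation_rate:
  assumes "u \<noteq> 0"
  shows "u \<bullet> d = 0 \<longleftrightarrow> d = rotation_rate u d *\<^sub>R perp u"
proof
  assume "u \<bullet> d = 0"
  then have "(u \<bullet> u) *\<^sub>R d = (perp u \<bullet> d) *\<^sub>R perp u" using perp_decomp[of u d] by simp
  then have "(1 / (u \<bullet> u)) *\<^sub>R ((u \<bullet> u) *\<^sub>R d) = (1 / (u \<bullet> u)) *\<^sub>R ((perp u \<bullet> d) *\<^sub>R perp u)"
    by simp
  then show "d = rotation_rate u d *\<^sub>R perp u" using assms by (simp add: rotation_rate_def)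
next
  assume "d = rotation_rate u d *\<^sub>R perp u"
  then have "u \<bullet> d = rotation_rate u d * (u \<bullet> perp u)" by (metis inner_scaleR_right)
  then show "u \<bullet> d = 0" by (simp add: inner_vec2)
qed

lemma rotation_rate_perp: "u \<noteq> 0 \<Longrightarrow> rotation_rate u (c *\<^sub>R perp u) = c"
  by (simp add: rotation_rate_def inner_perp_perp)

section \<open>Angle variations in terms of edge rotation rates\<close>

lemma next_ix_prev_ix: "i \<in> {1..n} \<Longrightarrow> next_ix n (prev_ix n i) = i"
  and prev_ix_next_ix: "i \<in> {1..n} \<Longrightarrow> prev_ix n (next_ix n i) = i"
  and next_ix_mem: "i \<in> {1..n} \<Longrightarrow> next_ix n i \<in> {1..n}"
  and prev_ix_mem: "i \<in> {1..n} \<Longrightarrow> prev_ix n i \<in> {1..n}"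
  by (auto simp: next_ix_def prev_ix_def)

lemma sum_prev_ix: "(\<Sum>i=1..n. f (prev_ix n i) i) = (\<Sum>i=1..n. f i (next_ix n i))"
  by (rule sum.reindex_bij_witness[of _ "next_ix n" "prev_ix n"])
    (simp_all add: next_ix_prev_ix prev_ix_next_ix next_ix_mem prev_ix_mem del: atLeastAtMost_iff One_nat_def)

lemma induces_angle_variation_iff:
  assumes "polygon n v"
  shows "induces_angle_variation n v w a \<longleftrightarrow>
    (\<forall>i\<in>{1..n}. a i = rotation_rate (v i - v (prev_ix n i)) (w i - w (prev_ix n i))
                  - rotation_rate (v (next_ix n i) - v i) (w (next_ix n i) - w i))"
proof -
  have "has_angle_derivative (\<lambda>t. polygon_angle n (\<lambda>j. v j + t *\<^sub>R w j) i) x 0 \<longleftrightarrow>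
      x = rotation_rate (v i - v (prev_ix n i)) (w i - w (prev_ix n i))
        - rotation_rate (v (next_ix n i) - v i) (w (next_ix n i) - w i)" (is "?L x \<longleftrightarrow> x = ?r")
    if i: "i \<in> {1..n}" for i x
  proof -
    let ?p = "prev_ix n i" and ?s = "next_ix n i"
    have "v ?s - v i \<noteq> 0" "v ?p - v i \<noteq> 0"
      using assms i prev_ix_mem[OF i] next_ix_prev_ix[OF i] unfolding polygon_def
      by fastforce+
    note has_angle_derivative_oriented_angle[OF this, of "w ?s - w i" "w ?p - w i"]
    \<comment> \<open>The second side of the angle at \<open>v i\<close> is the incoming edge
      reversed, and reversal does not change its rotation rate.\<close>
    moreover have "rotation_rate (v ?p - v i) (w ?p - w i) = rotation_rate (v i - v ?p) (w i - w ?p)"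
      using rotation_rate_minus[of "v i - v ?p" "w i - w ?p"] by simp
    moreover have "polygon_angle n (\<lambda>j. v j + t *\<^sub>R w j) i =
        oriented_angle (v ?s - v i + t *\<^sub>R (w ?s - w i)) (v ?p - v i + t *\<^sub>R (w ?p - w i))" for t
      by (simp add: polygon_angle_def algebra_simps)
    ultimately have "?L ?r" by simp
    then show ?thesis using has_angle_derivative_unique by blast
  qed
  then show ?thesis unfolding induces_angle_variation_def by blast
qed

text \<open>A velocity orthogonal to a nonzero edge is a multiple of the edge's quarter turn. The
  coefficient is unique, so any admissible rates agree with the actual rotation rates on all
  indices.\<close>

lemma isometric_variation_iff:
  assumes "polygon n v"
  shows "isometric_deformation n v w \<and> induces_angle_variation n v w a \<longleftrightarrow>
    (\<exists>\<omega>. (\<forall>i\<in>{1..n}. w (next_ix n i) - w i = \<omega> i *\<^sub>R perp (v (next_ix n i) - v i)) \<and>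
         (\<forall>i\<in>{1..n}. a i = \<omega> (prev_ix n i) - \<omega> i))"
    (is "_ \<longleftrightarrow> (\<exists>\<omega>. ?E \<omega> \<and> ?A \<omega>)")
proof -
  define \<rho> where "\<rho> i = rotation_rate (v (next_ix n i) - v i) (w (next_ix n i) - w i)" for i
  have nz: "v (next_ix n i) - v i \<noteq> 0" if "i \<in> {1..n}" for i
    using assms that unfolding polygon_def by fastforce
  have iso: "isometric_deformation n v w \<longleftrightarrow> ?E \<rho>"
    unfolding isometric_deformation_def \<rho>_def
    using orthogonal_iff_rotation_rate[OF nz] by blast
  have ind: "induces_angle_variation n v w a \<longleftrightarrow> ?A \<rho>"
    unfolding induces_angle_variation_iff[OF assms] \<rho>_def
    by (rule ball_cong[OF refl]) (simp add: next_ix_prev_ix del: atLeastAtMost_iff)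
  have "\<omega> i = \<rho> i" if "?E \<omega>" "i \<in> {1..n}" for \<omega> i
    using that rotation_rate_perp[OF nz] by (simp add: \<rho>_def del: atLeastAtMost_iff)
  then have "?E \<rho> \<and> ?A \<rho>" if "?E \<omega>" "?A \<omega>" for \<omega>
    using that prev_ix_mem by (metis (no_types, lifting))
  then show ?thesis using iso ind by blast
qed

section \<open>Summation by parts and cyclic difference equations\<close>

lemma sum_differences_prev_ix:
  "(\<Sum>i=1..n. (\<omega> (prev_ix n i) - \<omega> i) *\<^sub>R v i) = (\<Sum>i=1..n. \<omega> i *\<^sub>R (v (next_ix n i) - v i))"
  for v :: "nat \<Rightarrow> 'a::real_vector"
  using sum_prev_ix[of "\<lambda>i j. \<omega> i *\<^sub>R v j" n]
  by (simp add: scaleR_diff_left scaleR_diff_right sum_subtractf)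

lemma sum_next_ix_diff: "(\<Sum>i=1..n. w (next_ix n i) - w i) = 0"
  for w :: "nat \<Rightarrow> 'a::ab_group_add"
  using sum_prev_ix[of "\<lambda>i j. w j" n] by (simp add: sum_subtractf)

text \<open>Partial sums solve the equation along 1, ..., n; the vanishing total is what makes the
  closing step from n back to 1 consistent.\<close>

lemma next_ix_differences_exist:
  fixes d :: "nat \<Rightarrow> 'a::ab_group_add"
  assumes "(\<Sum>i=1..n. d i) = 0"
  shows "\<exists>w. \<forall>i\<in>{1..n}. w (next_ix n i) - w i = d i"
proof (intro exI ballI)
  fix i assume i: "i \<in> {1..n}"
  let ?w = "\<lambda>i. \<Sum>j=1..<i. d j"
  have "?w (Suc i) - ?w i = d i" using i by simp
  moreover have "?w (Suc n) = ?w 1" using assms by (simp add: atLeastLessThanSuc_atLeastAtMost)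
  ultimately show "?w (next_ix n i) - ?w i = d i" by (auto simp: next_ix_def)
qed

lemma next_ix_invariant_const:
  assumes "\<And>i. i \<in> {1..n} \<Longrightarrow> f (next_ix n i) = f i" "i \<in> {1..n}"
  shows "f i = f 1"
proof -
  have "1 \<le> i \<Longrightarrow> i \<le> n \<Longrightarrow> f i = f 1"
  proof (induction i rule: dec_induct)
    case (step k)
    then show ?case using assms(1)[of k] by (simp add: next_ix_def)
  qed simp
  then show ?thesis using assms(2) by simp
qed

section \<open>Necessity, existence and uniqueness\<close>

lemma isometric_variation_sums:
  assumes "polygon n v" "isometric_deformation n v w" "induces_angle_variation n v w a"
  shows "(\<Sum>i=1..n. a i) = 0" "(\<Sum>i=1..n. a i *\<^sub>R v i) = 0"
proof -
  obtain \<omega> where E: "\<forall>i\<in>{1..n}. w (next_ix n i) - w i = \<omega> i *\<^sub>R perp (v (next_ix n i) - v i)"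
    and A: "\<forall>i\<in>{1..n}. a i = \<omega> (prev_ix n i) - \<omega> i"
    using isometric_variation_iff[OF assms(1)] assms(2,3) by blast
  \<comment> \<open>Summation by parts with all \<open>v i\<close> equal to the number 1: every edge
    difference is then 0.\<close>
  show "(\<Sum>i=1..n. a i) = 0"
    using A sum_differences_prev_ix[where v = "\<lambda>_. 1::real" and \<omega> = \<omega> and n = n] by simp
  \<comment> \<open>The velocities of the edges sum to zero around the polygon, and
    \<open>perp\<close> is injective.\<close>
  have "perp (\<Sum>i=1..n. \<omega> i *\<^sub>R (v (next_ix n i) - v i)) = (\<Sum>i=1..n. w (next_ix n i) - w i)"
    using E by (simp add: linear_sum[OF linear_perp] linear_cmul[OF linear_perp])
  then have "perp (\<Sum>i=1..n. \<omega> i *\<^sub>R (v (next_ix n i) - v i)) = 0"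
    by (simp only: sum_next_ix_diff)
  then have "(\<Sum>i=1..n. \<omega> i *\<^sub>R (v (next_ix n i) - v i)) = 0"
    by (simp add: perp_def vec_eq_iff forall_2)
  then show "(\<Sum>i=1..n. a i *\<^sub>R v i) = 0"
    using A sum_differences_prev_ix[of \<omega> n v] by simp
qed

lemma isometric_variation_exists:
  assumes "polygon n v" "(\<Sum>i=1..n. a i) = 0" "(\<Sum>i=1..n. a i *\<^sub>R v i) = 0"
  shows "\<exists>w. isometric_deformation n v w \<and> induces_angle_variation n v w a"
proof -
  \<comment> \<open>Solves \<open>a i = \<omega> (i - 1) - \<omega> i\<close> from
    \<open>\<omega> 0 = 0\<close>. At i = 1 the predecessor is n instead, and
    \<open>\<omega> n = 0\<close> because the \<open>a i\<close> sum to zero.\<close>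
  define \<omega> where "\<omega> i = - (\<Sum>j=1..i. a j)" for i
  have A: "a i = \<omega> (prev_ix n i) - \<omega> i" if "i \<in> {1..n}" for i
    using that assms(2) by (cases i) (auto simp: \<omega>_def prev_ix_def)
  have "(\<Sum>i=1..n. \<omega> i *\<^sub>R (v (next_ix n i) - v i)) = (\<Sum>i=1..n. a i *\<^sub>R v i)"
    unfolding sum_differences_prev_ix[symmetric] using A by (intro sum.cong) auto
  then have "perp (\<Sum>i=1..n. \<omega> i *\<^sub>R (v (next_ix n i) - v i)) = 0"
    using assms(3) linear_0[OF linear_perp] by simp
  then have "(\<Sum>i=1..n. \<omega> i *\<^sub>R perp (v (next_ix n i) - v i)) = 0"
    by (simp add: linear_sum[OF linear_perp] linear_cmul[OF linear_perp])
  from next_ix_differences_exist[OF this] show ?thesis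
    unfolding isometric_variation_iff[OF assms(1)] using A by blast
qed

text \<open>A translation plus an infinitesimal rotation: the derivative is a multiple of
  \<open>perp\<close>, which is skew.\<close>

lemma killing_field_perp: "killing_field (\<lambda>x. b + c *\<^sub>R perp x)"
proof -
  have "((\<lambda>x. b + c *\<^sub>R perp x) has_derivative (\<lambda>h. c *\<^sub>R perp h)) (at x)" for x
    by (auto intro!: derivative_eq_intros linear_imp_has_derivative linear_perp)
  moreover have "(c *\<^sub>R perp u) \<bullet> w + u \<bullet> (c *\<^sub>R perp w) = 0" for u w
    by (simp add: inner_vec2 algebra_simps)
  ultimately show ?thesis unfolding killing_field_def by blast
qed

lemma isometric_variation_unique:
  assumes "polygon n v"
    and "isometric_deformation n v w" "induces_angle_variation n v w a"
    and "isometric_deformation n v w'" "induces_angle_variation n v w' a"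
  shows "trivial_deformation n v (\<lambda>i. w' i - w i)"
proof -
  obtain \<omega> where E: "\<forall>i\<in>{1..n}. w (next_ix n i) - w i = \<omega> i *\<^sub>R perp (v (next_ix n i) - v i)"
    and A: "\<forall>i\<in>{1..n}. a i = \<omega> (prev_ix n i) - \<omega> i"
    using isometric_variation_iff[OF assms(1)] assms(2,3) by blast
  obtain \<omega>' where E': "\<forall>i\<in>{1..n}. w' (next_ix n i) - w' i = \<omega>' i *\<^sub>R perp (v (next_ix n i) - v i)"
    and A': "\<forall>i\<in>{1..n}. a i = \<omega>' (prev_ix n i) - \<omega>' i"
    using isometric_variation_iff[OF assms(1)] assms(4,5) by blast
  \<comment> \<open>Both families of rates have the same cyclic differences, so they differ by one
    constant: the angular velocity of the trivial deformation sought.\<close>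
  define c where "c = \<omega>' 1 - \<omega> 1"
  have c: "\<omega>' i - \<omega> i = c" if "i \<in> {1..n}" for i
    unfolding c_def
  proof (rule next_ix_invariant_const[OF _ that])
    fix i assume i: "i \<in> {1..n}"
    note next_ix_mem[OF i]
    then have "\<omega> i - \<omega> (next_ix n i) = \<omega>' i - \<omega>' (next_ix n i)"
      using A A' prev_ix_next_ix[OF i] by metis
    then show "\<omega>' (next_ix n i) - \<omega> (next_ix n i) = \<omega>' i - \<omega> i" by simp
  qed
  \<comment> \<open>What is left after subtracting the infinitesimal rotation; it does not change
    along any edge, so it is a translation.\<close>
  define g where "g i = w' i - w i - c *\<^sub>R perp (v i)" for i
  have g: "g i = g 1" if "i \<in> {1..n}" for i
  proof (rule next_ix_invariant_const[OF _ that])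
    fix i assume i: "i \<in> {1..n}"
    have "g (next_ix n i) - g i = (w' (next_ix n i) - w' i) - (w (next_ix n i) - w i)
        - c *\<^sub>R perp (v (next_ix n i) - v i)"
      by (simp add: g_def linear_diff[OF linear_perp] algebra_simps)
    also have "\<dots> = (\<omega>' i - \<omega> i - c) *\<^sub>R perp (v (next_ix n i) - v i)"
      using E E' i by (simp add: algebra_simps del: atLeastAtMost_iff)
    finally show "g (next_ix n i) = g i" using c[OF i] by simp
  qed
  have "w' i - w i = g 1 + c *\<^sub>R perp (v i)" if "i \<in> {1..n}" for i
    using g[OF that] by (simp add: g_def algebra_simps)
  then show ?thesis unfolding trivial_deformation_def using killing_field_perp by blast
qed

theorem proposition1p1:
  fixes n :: nat and v :: "nat \<Rightarrow> real^2" and a :: "nat \<Rightarrow> real"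
  assumes "polygon n v"
  shows "((\<exists>w. isometric_deformation n v w \<and> induces_angle_variation n v w a) \<longrightarrow>
            (\<Sum>i=1..n. a i) = 0 \<and> (\<Sum>i=1..n. a i *\<^sub>R v i) = 0)
       \<and> ((\<Sum>i=1..n. a i) = 0 \<and> (\<Sum>i=1..n. a i *\<^sub>R v i) = 0 \<and> \<not> collinear (v ` {1..n}) \<longrightarrow>
            (\<exists>w. isometric_deformation n v w \<and> induces_angle_variation n v w a) \<and>
            (\<forall>w w'. isometric_deformation n v w \<and> induces_angle_variation n v w a \<and>
                    isometric_deformation n v w' \<and> induces_angle_variation n v w' a \<longrightarrow>
                    trivial_deformation n v (\<lambda>i. w' i - w i)))"
  using isometric_variation_sums[OF assms] isometric_variation_exists[OF assms]
    isometric_variation_unique[OF assms] by blast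

end
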